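(* Let $B$ be any group and let $p \ge 2$ be an integer. Then $cw(B \wr C_p) \le \max(1, cw(B))$.
   Context: $C_p$ is the cyclic group of order $p$ generated by the cycle $\sigma=(1,2,\ldots,p)$ and acting naturally (by shift) on $X=\{1,\ldots,p\}$. $B\wr C_p$ is the permutational wreath product, i.e. the semidirect product of $B^p$ with $C_p$, where $C_p$ permutes the direct factors. Notation: $[a,b]=aba^{-1}b^{-1}$, and $G'=[G,G]$ is the derived subgroup of $G$. The commutator length of $g\in G'$ is the minimal $n$ such that $g=[x_1,y_1]\cdots[x_n,y_n]$ for some $x_i,y_i\in G$ (the identity has commutator length $0$). The commutator width $cw(G)$ is the maximum of the commutator lengths of the elements of $G'$ ($\infty$ if these are unbounded). *)

theory Defs
  imports "HOL-Algebra.Algebra" "HOL-Library.Extended_Nat"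
begin

definition commutator :: "('a, 'b) monoid_scheme \<Rightarrow> 'a \<Rightarrow> 'a \<Rightarrow> 'a" where
  "commutator G x y = x \<otimes>\<^bsub>G\<^esub> y \<otimes>\<^bsub>G\<^esub> inv\<^bsub>G\<^esub> x \<otimes>\<^bsub>G\<^esub> inv\<^bsub>G\<^esub> y"

definition product_of_commutators ::
    "('a, 'b) monoid_scheme \<Rightarrow> nat \<Rightarrow> 'a \<Rightarrow> bool" where
  "product_of_commutators G n g \<longleftrightarrow>
     (\<exists>cs. length cs = n \<and> set cs \<subseteq> carrier G \<times> carrier G \<and>
           g = foldr (\<lambda>(x, y) r. commutator G x y \<otimes>\<^bsub>G\<^esub> r) cs \<one>\<^bsub>G\<^esub>)"

text \<open>For an element of the derived subgroup the infimum is attained, so it is the minimal number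
  of commutators; outside the derived subgroup the value is \<open>\<infinity>\<close>.\<close>

definition commutator_length :: "('a, 'b) monoid_scheme \<Rightarrow> 'a \<Rightarrow> enat" where
  "commutator_length G g = (INF n \<in> {n. product_of_commutators G n g}. enat n)"

text \<open>A supremum of a nonempty set in \<open>enat\<close> is its maximum if the set is bounded in the natural
  numbers, and \<open>\<infinity>\<close> otherwise.\<close>

definition commutator_width :: "('a, 'b) monoid_scheme \<Rightarrow> enat" where
  "commutator_width G = (SUP g \<in> derived G (carrier G). commutator_length G g)"

definition semidirect_product ::
    "('n, 'b) monoid_scheme \<Rightarrow> ('h, 'c) monoid_scheme \<Rightarrow> ('h \<Rightarrow> 'n \<Rightarrow> 'n) \<Rightarrow> ('n \<times> 'h) monoid" where
  "semidirect_product N H \<phi> =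
     \<lparr> carrier = carrier N \<times> carrier H,
       monoid.mult = (\<lambda>(x, s) (y, t). (x \<otimes>\<^bsub>N\<^esub> \<phi> s y, s \<otimes>\<^bsub>H\<^esub> t)),
       one = (\<one>\<^bsub>N\<^esub>, \<one>\<^bsub>H\<^esub>) \<rparr>"

text \<open>The inverse makes this a left action: the \<open>i\<close>-th coordinate of \<open>f\<close> is moved to position
  \<open>s i\<close>.\<close>

definition permute_coordinates :: "'x set \<Rightarrow> ('x \<Rightarrow> 'x) \<Rightarrow> ('x \<Rightarrow> 'a) \<Rightarrow> ('x \<Rightarrow> 'a)" where
  "permute_coordinates I s f = (\<lambda>i\<in>I. f (inv' s i))"

definition wreath_product ::
    "('a, 'b) monoid_scheme \<Rightarrow> 'x set \<Rightarrow> ('x \<Rightarrow> 'x, 'c) monoid_scheme \<Rightarrow> (('x \<Rightarrow> 'a) \<times> ('x \<Rightarrow> 'x)) monoid" where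
  "wreath_product B I P =
     semidirect_product (product_group I (\<lambda>_. B)) P (permute_coordinates I)"

definition cyclic_perm_group :: "nat \<Rightarrow> (nat \<Rightarrow> nat) monoid" where
  "cyclic_perm_group p = subgroup_generated (sym_group p) {cycle_of_list [1..<Suc p]}"

lemma group_semidirect_product:
  assumes N: "group N" and H: "group H"
    and hom: "\<And>s. s \<in> carrier H \<Longrightarrow> \<phi> s \<in> hom N N"
    and one: "\<And>x. x \<in> carrier N \<Longrightarrow> \<phi> \<one>\<^bsub>H\<^esub> x = x"
    and comp: "\<And>s t x. \<lbrakk>s \<in> carrier H; t \<in> carrier H; x \<in> carrier N\<rbrakk>
                 \<Longrightarrow> \<phi> (s \<otimes>\<^bsub>H\<^esub> t) x = \<phi> s (\<phi> t x)"
  shows "group (semidirect_product N H \<phi>)"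
proof -
  interpret N: group N by (rule N)
  interpret H: group H by (rule H)
  have cl: "\<phi> s x \<in> carrier N" if "s \<in> carrier H" "x \<in> carrier N" for s x
    using hom[OF that(1)] that(2) by (auto simp: hom_def)
  have mu: "\<phi> s (x \<otimes>\<^bsub>N\<^esub> y) = \<phi> s x \<otimes>\<^bsub>N\<^esub> \<phi> s y"
    if "s \<in> carrier H" "x \<in> carrier N" "y \<in> carrier N" for s x y
    using hom[OF that(1)] that(2,3) by (auto simp: hom_def)
  have ex: "\<exists>z\<in>carrier N \<times> carrier H.
              (case z of (y, t) \<Rightarrow> \<lambda>(x, s). (y \<otimes>\<^bsub>N\<^esub> \<phi> t x, t \<otimes>\<^bsub>H\<^esub> s)) (x, s) = (\<one>\<^bsub>N\<^esub>, \<one>\<^bsub>H\<^esub>)"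
    if "x \<in> carrier N" "s \<in> carrier H" for x s
    by (rule bexI[of _ "(inv\<^bsub>N\<^esub> (\<phi> (inv\<^bsub>H\<^esub> s) x), inv\<^bsub>H\<^esub> s)"]) (use that cl in auto)
  show ?thesis
    by (rule groupI) (use ex in \<open>auto simp: semidirect_product_def cl mu comp one
          N.m_assoc H.m_assoc intro: hom_one\<close>)
qed

lemma cycle_in_sym_group: "cycle_of_list [1..<Suc p] \<in> carrier (sym_group p)"
  using cycle_permutes[of "[1..<Suc p]"]
  by (simp add: sym_group_carrier atLeastLessThanSuc_atLeastAtMost del: upt_Suc)

lemma group_cyclic_perm_group: "group (cyclic_perm_group p)"
  unfolding cyclic_perm_group_def
  by (rule group.group_subgroup_generated[OF sym_group_is_group])

lemma cyclic_perm_group_simps: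
  shows "carrier (cyclic_perm_group p) = range (\<lambda>n::int. cycle_of_list [1..<Suc p] [^]\<^bsub>sym_group p\<^esub> n)"
    and "monoid.mult (cyclic_perm_group p) = (\<circ>)"
    and "one (cyclic_perm_group p) = id"
  unfolding cyclic_perm_group_def
  using group.carrier_subgroup_generated_by_singleton[OF sym_group_is_group cycle_in_sym_group]
  by (auto simp: sym_group_mult sym_group_one simp del: upt_Suc)

lemma cyclic_perm_group_permutes:
  assumes "s \<in> carrier (cyclic_perm_group p)"
  shows "s permutes {1..p}"
proof -
  have "carrier (cyclic_perm_group p) \<subseteq> carrier (sym_group p)"
    unfolding cyclic_perm_group_def
    by (rule group.carrier_subgroup_generated_subset[OF sym_group_is_group])
  with assms show ?thesis by (auto simp: sym_group_carrier)
qed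

lemma group_wreath_product_cyclic:
  assumes "group B"
  shows "group (wreath_product B {1..p} (cyclic_perm_group p))"
  unfolding wreath_product_def
proof (rule group_semidirect_product)
  fix s assume s: "s \<in> carrier (cyclic_perm_group p)"
  have "inv' s permutes {1..p}"
    by (rule permutes_inv[OF cyclic_perm_group_permutes[OF s]])
  then have *: "inv' s i \<in> {1..p}" if "i \<in> {1..p}" for i
    using that permutes_in_image by metis
  show "permute_coordinates {1..p} s
          \<in> hom (product_group {1..p} (\<lambda>_. B)) (product_group {1..p} (\<lambda>_. B))"
    using * by (fastforce simp: hom_def permute_coordinates_def PiE_iff intro!: restrict_ext)
next
  fix x assume "x \<in> carrier (product_group {1..p} (\<lambda>_. B))"
  then show "permute_coordinates {1..p} \<one>\<^bsub>cyclic_perm_group p\<^esub> x = x"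
    by (auto simp: permute_coordinates_def cyclic_perm_group_simps PiE_iff inv_id
        intro!: extensionalityI[of _ "{1..p}"])
next
  fix s t x
  assume s: "s \<in> carrier (cyclic_perm_group p)" and t: "t \<in> carrier (cyclic_perm_group p)"
  have ps: "s permutes {1..p}" and pt: "t permutes {1..p}"
    using s t by (auto dest: cyclic_perm_group_permutes)
  have *: "inv' s i \<in> {1..p}" if "i \<in> {1..p}" for i
    using that permutes_in_image[OF permutes_inv[OF ps]] by metis
  have "inv' (s \<circ> t) = inv' t \<circ> inv' s"
    by (rule o_inv_distrib) (use ps pt permutes_bij in auto)
  then show "permute_coordinates {1..p} (s \<otimes>\<^bsub>cyclic_perm_group p\<^esub> t) x
          = permute_coordinates {1..p} s (permute_coordinates {1..p} t x)"
    using * by (auto simp: permute_coordinates_def cyclic_perm_group_simps intro!: restrict_ext)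
qed (use assms group_cyclic_perm_group in auto)

end

theory Submission
  imports Defs
begin

text \<open>An element of the derived subgroup of the wreath product lies in the base group, and the
  product of its coordinates, in any order, lies in the derived subgroup of \<open>B\<close>. So for
  \<open>f = (f\<^sub>1, \<dots>, f\<^sub>p)\<close> in the derived subgroup write \<open>f\<^sub>p \<cdots> f\<^sub>1 = [a\<^sub>1,b\<^sub>1] \<cdots> [a\<^sub>n,b\<^sub>n]\<close> in \<open>B\<close> with
  \<open>n \<ge> 1\<close>. Splitting off \<open>[a\<^sub>2,b\<^sub>2] \<cdots> [a\<^sub>n,b\<^sub>n]\<close> in the first coordinate reduces to
  \<open>f\<^sub>p \<cdots> f\<^sub>1 = [a,b]\<close>. Then \<open>f = [h, k\<sigma>]\<close> for \<open>k = (b, 1, \<dots>, 1)\<close> and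
  \<open>h\<^sub>i = f\<^sub>i \<cdots> f\<^sub>1 b a b\<^sup>-\<^sup>1\<close>: the equations in the coordinates \<open>i > 1\<close> hold by construction, and the
  one in the first coordinate amounts to \<open>h\<^sub>p = a\<close>.\<close>

section \<open>Commutators\<close>

lemma (in group) commutator_closed [simp, intro]:
  assumes "x \<in> carrier G" "y \<in> carrier G"
  shows "commutator G x y \<in> carrier G"
  using assms by (simp add: commutator_def)

text \<open>In this form only products have to be computed: no explicit formula for inverses in the
  wreath product is called for.\<close>

lemma (in group) commutator_eqI:
  assumes "x \<in> carrier G" "y \<in> carrier G" "g \<in> carrier G"
    and "x \<otimes> y = g \<otimes> (y \<otimes> x)"
  shows "commutator G x y = g"
proof -
  have "commutator G x y = x \<otimes> y \<otimes> inv (y \<otimes> x)"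
    using assms(1-3) by (simp add: commutator_def inv_mult_group m_assoc)
  also have "\<dots> = g \<otimes> (y \<otimes> x) \<otimes> inv (y \<otimes> x)"
    by (simp only: assms(4))
  also have "\<dots> = g"
    using assms(1-3) by (simp add: m_assoc del: inv_mult_group)
  finally show ?thesis .
qed

lemma (in group_hom) hom_commutator:
  assumes "x \<in> carrier G" "y \<in> carrier G"
  shows "h (commutator G x y) = commutator H (h x) (h y)"
  using assms by (simp add: commutator_def)

lemma product_of_commutators_0: "product_of_commutators G 0 g \<longleftrightarrow> g = \<one>\<^bsub>G\<^esub>"
  by (auto simp: product_of_commutators_def)

lemma product_of_commutators_Suc:
  "product_of_commutators G (Suc n) g \<longleftrightarrow>
     (\<exists>x\<in>carrier G. \<exists>y\<in>carrier G. \<exists>r. product_of_commutators G n r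
        \<and> g = commutator G x y \<otimes>\<^bsub>G\<^esub> r)" (is "?L \<longleftrightarrow> ?R")
proof
  assume ?L
  then obtain cs where cs: "length cs = Suc n" "set cs \<subseteq> carrier G \<times> carrier G"
    "g = foldr (\<lambda>(x, y) r. commutator G x y \<otimes>\<^bsub>G\<^esub> r) cs \<one>\<^bsub>G\<^esub>"
    unfolding product_of_commutators_def by blast
  then obtain x y ds where "cs = (x, y) # ds"
    by (cases cs) auto
  with cs show ?R
    unfolding product_of_commutators_def by auto
next
  assume ?R
  then obtain x y cs where "x \<in> carrier G" "y \<in> carrier G" "length cs = n"
    "set cs \<subseteq> carrier G \<times> carrier G"
    "g = commutator G x y \<otimes>\<^bsub>G\<^esub> foldr (\<lambda>(x, y) r. commutator G x y \<otimes>\<^bsub>G\<^esub> r) cs \<one>\<^bsub>G\<^esub>"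
    unfolding product_of_commutators_def by blast
  then show ?L
    unfolding product_of_commutators_def by (intro exI[of _ "(x, y) # cs"]) auto
qed

lemma (in group) product_of_commutators_closed:
  "product_of_commutators G n g \<Longrightarrow> g \<in> carrier G"
  by (induction n arbitrary: g)
    (auto simp: product_of_commutators_0 product_of_commutators_Suc)

lemma (in group_hom) product_of_commutators_hom:
  "product_of_commutators G n g \<Longrightarrow> product_of_commutators H n (h g)"
proof (induction n arbitrary: g)
  case (Suc n)
  then obtain x y r where xyr: "x \<in> carrier G" "y \<in> carrier G" "product_of_commutators G n r"
    "g = commutator G x y \<otimes> r"
    by (auto simp: product_of_commutators_Suc)
  then have "h g = commutator H (h x) (h y) \<otimes>\<^bsub>H\<^esub> h r"
    by (simp add: hom_commutator G.product_of_commutators_closed)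
  with xyr Suc.IH[of r] show ?case
    unfolding product_of_commutators_Suc by (blast intro: hom_closed)
qed (simp add: product_of_commutators_0)

text \<open>Pad with the trivial commutator [1,1]. An exact number of commutators thus also serves
  as an upper bound.\<close>

lemma (in group) product_of_commutators_mono:
  assumes "product_of_commutators G m g" "m \<le> n"
  shows "product_of_commutators G n g"
  using assms(2,1)
proof (induction n rule: dec_induct)
  case (step n)
  then have "g \<in> carrier G"
    by (blast intro: product_of_commutators_closed)
  then have "g = commutator G \<one> \<one> \<otimes> g"
    by (simp add: commutator_def)
  with step show ?case
    by (auto simp: product_of_commutators_Suc)
qed

text \<open>The infimum of the empty set is infinity, so a finite bound forces a nonempty set of
  lengths. Its infimum is then attained, and padding leads from there up to
  \<open>n\<close>.\<close>

lemma (in group) commutator_length_le_iff: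
  "commutator_length G g \<le> enat n \<longleftrightarrow> product_of_commutators G n g"
proof
  assume le: "commutator_length G g \<le> enat n"
  let ?S = "enat ` {n. product_of_commutators G n g}"
  have "?S \<noteq> {}"
  proof
    assume "?S = {}"
    then have "commutator_length G g = \<infinity>"
      by (simp only: commutator_length_def) (simp add: top_enat_def)
    with le show False
      by simp
  qed
  then have "Inf ?S \<in> ?S"
    by (auto simp: Inf_enat_def intro: LeastI)
  then obtain m where "product_of_commutators G m g" "commutator_length G g = enat m"
    by (auto simp: commutator_length_def)
  with le show "product_of_commutators G n g"
    by (auto intro: product_of_commutators_mono)
next
  assume "product_of_commutators G n g"
  then show "commutator_length G g \<le> enat n"
    unfolding commutator_length_def by (intro INF_lower) simp
qed

text \<open>The derived subgroup is mapped into the derived subgroup generated by the image, which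
  is trivial inside an abelian group.\<close>

lemma (in group) hom_comm_group_derived:
  assumes "\<phi> \<in> hom G H" "comm_group H" "g \<in> derived G (carrier G)"
  shows "\<phi> g = \<one>\<^bsub>H\<^esub>"
proof -
  interpret H: comm_group H by fact
  interpret group_hom G H \<phi>
    by unfold_locales fact
  have "\<phi> g \<in> derived H (\<phi> ` carrier G)"
    using derived_img[of "carrier G"] assms(3) by blast
  then show ?thesis
    using H.derived_eq_singleton[of "\<phi> ` carrier G"] by (auto simp: image_subset_iff)
qed

section \<open>The wreath product with a cyclic group\<close>

lemma carrier_wreath_product:
  "carrier (wreath_product B I P) = (\<Pi>\<^sub>E i\<in>I. carrier B) \<times> carrier P"
  by (simp add: wreath_product_def semidirect_product_def)

lemma mult_wreath_product:
  "(f, s) \<otimes>\<^bsub>wreath_product B I P\<^esub> (g, t)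
     = ((\<lambda>i\<in>I. f i \<otimes>\<^bsub>B\<^esub> permute_coordinates I s g i), s \<otimes>\<^bsub>P\<^esub> t)"
  by (simp add: wreath_product_def semidirect_product_def)

section \<open>The cyclic group and its generating shift\<close>

lemma comm_group_cyclic_perm_group: "comm_group (cyclic_perm_group p)"
proof (rule group.group_comm_groupI[OF group_cyclic_perm_group])
  interpret S: group "sym_group p"
    by (rule sym_group_is_group)
  let ?c = "cycle_of_list [1..<Suc p]"
  fix s t assume "s \<in> carrier (cyclic_perm_group p)" "t \<in> carrier (cyclic_perm_group p)"
  then obtain m n :: int where "s = ?c [^]\<^bsub>sym_group p\<^esub> m" "t = ?c [^]\<^bsub>sym_group p\<^esub> n"
    unfolding cyclic_perm_group_simps by blast
  then have "s \<otimes>\<^bsub>sym_group p\<^esub> t = t \<otimes>\<^bsub>sym_group p\<^esub> s"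
    using S.int_pow_mult[OF cycle_in_sym_group, of m n] S.int_pow_mult[OF cycle_in_sym_group, of n m]
    by (simp add: add.commute)
  then show "s \<otimes>\<^bsub>cyclic_perm_group p\<^esub> t = t \<otimes>\<^bsub>cyclic_perm_group p\<^esub> s"
    by (simp add: cyclic_perm_group_simps sym_group_mult)
qed

lemma cycle_in_cyclic_perm_group: "cycle_of_list [1..<Suc p] \<in> carrier (cyclic_perm_group p)"
  unfolding cyclic_perm_group_def
  using group.subgroup_generated_minimal cycle_in_sym_group
  by (metis IntI carrier_subgroup_generated generate.incl insertI1)

lemma inv_cycle_of_list_upt:
  assumes "i \<in> {1..p}"
  shows "inv' (cycle_of_list [1..<Suc p]) i = (if i = 1 then p else i - 1)"
proof -
  let ?c = "cycle_of_list [1..<Suc p]" and ?j = "if i = 1 then p else i - 1"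
  have j: "1 \<le> ?j" "?j \<le> p"
    using assms by auto
  have "map ?c [1..<Suc p] = rotate1 [1..<Suc p]"
    using cyclic_rotation[of "[1..<Suc p]" 1] by (simp del: upt_Suc)
  \<comment> \<open>Positions count from 0, so place \<open>?j - 1\<close> holds \<open>?j\<close>
    in the list. In the rotated list it holds \<open>i\<close>, with 1 wrapped around to the last
    place.\<close>
  then have "map ?c [1..<Suc p] ! (?j - 1) = rotate1 [1..<Suc p] ! (?j - 1)"
    by simp
  moreover have "map ?c [1..<Suc p] ! (?j - 1) = ?c ?j"
    using j by (simp del: upt_Suc)
  moreover have "rotate1 [1..<Suc p] ! (?j - 1) = i"
    using j assms by (auto simp: nth_rotate1 simp del: upt_Suc)
  ultimately have "?c ?j = i"
    by simp
  then show ?thesis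
    using permutes_inv_eq[OF cycle_permutes[of "[1..<Suc p]"]] by metis
qed

section \<open>Ordered products of the coordinates\<close>

primrec desc_prod :: "('a, 'b) monoid_scheme \<Rightarrow> (nat \<Rightarrow> 'a) \<Rightarrow> nat \<Rightarrow> 'a" where
  "desc_prod G f 0 = \<one>\<^bsub>G\<^esub>"
| "desc_prod G f (Suc n) = f (Suc n) \<otimes>\<^bsub>G\<^esub> desc_prod G f n"

lemma (in group) desc_prod_closed [simp, intro]:
  "f \<in> {1..n} \<rightarrow> carrier G \<Longrightarrow> desc_prod G f n \<in> carrier G"
  by (induction n) (auto simp: Pi_iff)

text \<open>In descending order the first coordinate is the rightmost factor, so a factor appended
  to it is appended to the whole product. This serves to cancel surplus commutators.\<close>

lemma (in group) desc_prod_mult_first: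
  assumes "f \<in> {1..n} \<rightarrow> carrier G" "c \<in> carrier G" "1 \<le> n"
    and "g 1 = f 1 \<otimes> c" "\<And>i. \<lbrakk>1 < i; i \<le> n\<rbrakk> \<Longrightarrow> g i = f i"
  shows "desc_prod G g n = desc_prod G f n \<otimes> c"
  using assms(3,1,5)
proof (induction n rule: dec_induct)
  case base
  then show ?case
    using assms(2,4) by auto
next
  case (step n)
  then show ?case
    using assms(2) by (auto simp: Pi_iff m_assoc)
qed

text \<open>The quotient is abelian, so there the ordered product agrees with an unordered one,
  which permuting the coordinates leaves unchanged.\<close>

lemma (in group) desc_prod_Mod_derived:
  fixes n :: nat
  defines "A \<equiv> G Mod derived G (carrier G)"
  assumes "f \<in> {1..n} \<rightarrow> carrier G"
  shows "finprod A (\<lambda>i. derived G (carrier G) #> f i) {1..n}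
    = derived G (carrier G) #> desc_prod G f n"
proof -
  interpret N: normal "derived G (carrier G)" G
    by (rule derived_self_is_normal)
  interpret A: comm_group A
    unfolding A_def by (rule derived_quot_is_comm_group)
  have cos: "derived G (carrier G) #> x \<in> carrier A" if "x \<in> carrier G" for x
    using that by (auto simp: A_def FactGroup_def RCOSETS_def)
  show ?thesis
    using assms(2)
  proof (induction n)
    case 0
    then show ?case
      using A.finprod_empty by (simp add: A_def FactGroup_def N.subset coset_mult_one)
  next
    case (Suc n)
    have "{1..Suc n} = insert (Suc n) {1..n}"
      by auto
    then have "finprod A (\<lambda>i. derived G (carrier G) #> f i) {1..Suc n}
      = (derived G (carrier G) #> f (Suc n)) \<otimes>\<^bsub>A\<^esub> (derived G (carrier G) #> desc_prod G f n)"
      using Suc by (subst Suc.IH[symmetric]) (auto simp: Pi_iff cos intro!: A.finprod_insert)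
    also have "\<dots> = derived G (carrier G) #> desc_prod G f (Suc n)"
      using Suc.prems by (auto simp: A_def FactGroup_def N.rcos_sum Pi_iff)
    finally show ?case .
  qed
qed

text \<open>Two homomorphisms to abelian groups kill the derived subgroup: the projection to the
  cyclic group, and the map \<open>\<psi>\<close> multiplying the cosets of all coordinates modulo
  the derived subgroup of \<open>G\<close>.\<close>

lemma (in group) derived_wreath_productD:
  fixes p :: nat
  defines "W \<equiv> wreath_product G {1..p} (cyclic_perm_group p)"
  assumes fs: "(f, s) \<in> derived W (carrier W)"
  shows "s = id" "desc_prod G f p \<in> derived G (carrier G)"
proof -
  let ?D = "derived G (carrier G)" and ?I = "{1..p}"
  define A where "A = G Mod ?D"
  define \<psi> where "\<psi> = (\<lambda>w :: (nat \<Rightarrow> 'a) \<times> (nat \<Rightarrow> nat). finprod A (\<lambda>i. ?D #> fst w i) ?I)"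
  interpret N: normal ?D G
    by (rule derived_self_is_normal)
  interpret A: comm_group A
    unfolding A_def by (rule derived_quot_is_comm_group)
  interpret W: group W
    unfolding W_def by (rule group_wreath_product_cyclic) (rule is_group)
  have cos: "?D #> x \<in> carrier A" if "x \<in> carrier G" for x
    using that by (auto simp: A_def FactGroup_def RCOSETS_def)
  have mult: "?D #> (x \<otimes> y) = (?D #> x) \<otimes>\<^bsub>A\<^esub> (?D #> y)" if "x \<in> carrier G" "y \<in> carrier G" for x y
    using that by (simp add: A_def FactGroup_def N.rcos_sum)
  have "snd \<in> hom W (cyclic_perm_group p)"
    by (auto simp: hom_def W_def carrier_wreath_product mult_wreath_product)
  from W.hom_comm_group_derived[OF this comm_group_cyclic_perm_group fs] show "s = id"
    by (simp add: cyclic_perm_group_simps)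
  have "\<psi> \<in> hom W A"
  proof (rule homI)
    fix v assume "v \<in> carrier W"
    then show "\<psi> v \<in> carrier A"
      by (auto simp: \<psi>_def W_def carrier_wreath_product PiE_iff intro!: A.finprod_closed cos)
  next
    fix v w assume "v \<in> carrier W" "w \<in> carrier W"
    then obtain a s b t where v: "v = (a, s)" "a \<in> ?I \<rightarrow>\<^sub>E carrier G" "s \<in> carrier (cyclic_perm_group p)"
      and w: "w = (b, t)" "b \<in> ?I \<rightarrow>\<^sub>E carrier G" "t \<in> carrier (cyclic_perm_group p)"
      by (auto simp: W_def carrier_wreath_product)
    have perm: "inv' s permutes ?I"
      by (rule permutes_inv[OF cyclic_perm_group_permutes[OF v(3)]])
    have bs: "b (inv' s i) \<in> carrier G" if "i \<in> ?I" for i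
      using w(2) that permutes_in_image[OF perm] by blast
    have "\<psi> (v \<otimes>\<^bsub>W\<^esub> w) = finprod A (\<lambda>i. (?D #> a i) \<otimes>\<^bsub>A\<^esub> (?D #> b (inv' s i))) ?I"
      unfolding \<psi>_def using v w bs
      by (intro A.finprod_cong)
        (auto simp: W_def mult_wreath_product permute_coordinates_def simp_implies_def PiE_iff
          intro!: mult cos A.m_closed)
    also have "\<dots> = \<psi> v \<otimes>\<^bsub>A\<^esub> finprod A (\<lambda>i. ?D #> b (inv' s i)) ?I"
      unfolding \<psi>_def using v bs by (subst A.finprod_multf) (auto simp: PiE_iff intro!: cos)
    \<comment> \<open>The twist by \<open>s\<close> only reorders the factors, which is harmless in
      the abelian group \<open>A\<close>.\<close>
    also have "finprod A (\<lambda>i. ?D #> b (inv' s i)) ?I = finprod A (\<lambda>i. ?D #> b i) (inv' s ` ?I)"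
      using w(2) permutes_image[OF perm] permutes_inj_on[OF perm]
      by (intro A.finprod_reindex[symmetric]) (auto simp: PiE_iff intro!: cos)
    also have "\<dots> = \<psi> w"
      by (simp only: permutes_image[OF perm] \<psi>_def w fst_conv)
    finally show "\<psi> (v \<otimes>\<^bsub>W\<^esub> w) = \<psi> v \<otimes>\<^bsub>A\<^esub> \<psi> w" .
  qed
  then have "\<psi> (f, s) = \<one>\<^bsub>A\<^esub>"
    using W.hom_comm_group_derived A.comm_group_axioms fs by blast
  moreover have "(f, s) \<in> carrier W"
    using fs W.derived_in_carrier by blast
  then have f: "f \<in> ?I \<rightarrow> carrier G"
    by (auto simp: W_def carrier_wreath_product PiE_iff)
  ultimately have "?D #> desc_prod G f p = ?D"
    using desc_prod_Mod_derived[OF f] by (simp add: \<psi>_def A_def FactGroup_def)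
  then show "desc_prod G f p \<in> ?D"
    using rcos_self[OF desc_prod_closed[OF f] N.subgroup_axioms] by simp
qed

section \<open>Elements of the base group as products of commutators\<close>

lemma (in group) wreath_product_commutator:
  assumes p: "p \<ge> 1" and f: "f \<in> {1..p} \<rightarrow>\<^sub>E carrier G"
    and a: "a \<in> carrier G" and b: "b \<in> carrier G"
    and prod: "desc_prod G f p = commutator G a b"
  defines "W \<equiv> wreath_product G {1..p} (cyclic_perm_group p)"
  shows "\<exists>x\<in>carrier W. \<exists>y\<in>carrier W. commutator W x y = (f, id)"
proof -
  interpret W: group W
    unfolding W_def by (rule group_wreath_product_cyclic) (rule is_group)
  let ?\<sigma> = "cycle_of_list [1..<Suc p]" and ?I = "{1..p}"
  \<comment> \<open>Aiming at \<open>h p = a\<close>, the equation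
    \<open>h 1 \<otimes> b = f 1 \<otimes> (b \<otimes> h p)\<close> at coordinate 1 dictates
    \<open>h 1\<close>, and \<open>h i = f i \<otimes> h (i - 1)\<close> dictates the rest. The
    assumption \<open>prod\<close> is what closes the cycle.\<close>
  define h where "h = (\<lambda>i\<in>?I. desc_prod G f i \<otimes> (b \<otimes> a \<otimes> inv b))"
  define k where "k = (\<lambda>i\<in>?I. if i = 1 then b else \<one>)"
  have fi: "f i \<in> carrier G" if "i \<in> ?I" for i
    using f that by (auto simp: PiE_iff)
  have Pi: "desc_prod G f i \<in> carrier G" if "i \<le> p" for i
    using that by (intro desc_prod_closed) (auto intro: fi)
  have id: "id \<in> carrier (cyclic_perm_group p)"
    using group.is_monoid[OF group_cyclic_perm_group, THEN monoid.one_closed]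
    by (simp add: cyclic_perm_group_simps(3))
  have h: "(h, id) \<in> carrier W" and k: "(k, ?\<sigma>) \<in> carrier W" and f': "(f, id) \<in> carrier W"
    using a b f Pi id cycle_in_cyclic_perm_group
    by (auto simp: W_def carrier_wreath_product h_def k_def simp del: upt_Suc)
  have hp: "h p = a"
  proof -
    have "inv x \<otimes> (x \<otimes> y) = y" if "x \<in> carrier G" "y \<in> carrier G" for x y
      using that by (simp add: m_assoc[symmetric])
    then show ?thesis
      using p a b prod by (simp add: h_def commutator_def m_assoc)
  qed
  \<comment> \<open>This is coordinate \<open>i\<close> of xy = g(yx) for x =
    \<open>(h, id)\<close>, y = \<open>(k, ?\<sigma>)\<close>, g = \<open>(f, id)\<close>. Only
    \<open>?\<sigma>\<close> moves coordinates, so only \<open>h\<close> on the right is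
    shifted.\<close>
  have hk: "h i \<otimes> k i = f i \<otimes> (k i \<otimes> h (inv' ?\<sigma> i))" if i: "i \<in> ?I" for i
  proof (cases "i = 1")
    case True
    then have "h (inv' ?\<sigma> i) = a"
      using inv_cycle_of_list_upt[OF i] hp by simp
    moreover have "h i \<otimes> k i = f i \<otimes> (b \<otimes> a)"
      using True i a b fi[OF i] by (simp add: h_def k_def m_assoc)
    ultimately show ?thesis
      using True i by (simp add: k_def)
  next
    case False
    then obtain j where j: "i = Suc j" "j \<in> ?I"
      using i by (cases i) auto
    then have "inv' ?\<sigma> i = j"
      using inv_cycle_of_list_upt[OF i] False by simp
    moreover have "h i = f i \<otimes> h j"
      using j i a b fi[OF i] Pi[of j] by (simp add: h_def m_assoc)
    moreover have "h j \<in> carrier G" "h i \<in> carrier G"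
      using h i j by (auto simp: W_def carrier_wreath_product)
    ultimately show ?thesis
      using False i fi[OF i] by (simp add: k_def)
  qed
  have range: "inv' ?\<sigma> i \<in> ?I" if "i \<in> ?I" for i
    using inv_cycle_of_list_upt[OF that] that by auto
  have "(h, id) \<otimes>\<^bsub>W\<^esub> (k, ?\<sigma>) = (f, id) \<otimes>\<^bsub>W\<^esub> ((k, ?\<sigma>) \<otimes>\<^bsub>W\<^esub> (h, id))"
    using hk range
    by (auto simp: W_def mult_wreath_product permute_coordinates_def cyclic_perm_group_simps
        inv_id simp del: upt_Suc intro!: restrict_ext)
  then show ?thesis
    using W.commutator_eqI[OF h k f'] h k by blast
qed

text \<open>All commutators but the first are carried over from \<open>G\<close> by the embedding
  \<open>\<epsilon>\<close> into the first coordinate. The first one accounts for the rest of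
  \<open>f\<close>; it is spent even if the ordered product is trivial, whence the 1 in the final
  bound.\<close>

lemma (in group) wreath_product_product_of_commutators:
  assumes p: "p \<ge> 1" and n: "n \<ge> 1" and f: "f \<in> {1..p} \<rightarrow>\<^sub>E carrier G"
    and prod: "product_of_commutators G n (desc_prod G f p)"
  defines "W \<equiv> wreath_product G {1..p} (cyclic_perm_group p)"
  shows "product_of_commutators W n (f, id)"
proof -
  interpret W: group W
    unfolding W_def by (rule group_wreath_product_cyclic) (rule is_group)
  obtain m where m: "n = Suc m"
    using n by (cases n) auto
  let ?I = "{1..p}"
  define \<epsilon> where "\<epsilon> = (\<lambda>x. ((\<lambda>i\<in>?I. if i = 1 then x else \<one>), id :: nat \<Rightarrow> nat))"
  have id: "id \<in> carrier (cyclic_perm_group p)"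
    using group.is_monoid[OF group_cyclic_perm_group, THEN monoid.one_closed]
    by (simp add: cyclic_perm_group_simps(3))
  interpret \<epsilon>: group_hom G W \<epsilon>
    using id
    by unfold_locales
      (auto simp: hom_def W_def \<epsilon>_def carrier_wreath_product mult_wreath_product
        permute_coordinates_def cyclic_perm_group_simps inv_id intro!: restrict_ext)
  obtain a b r where a: "a \<in> carrier G" and b: "b \<in> carrier G"
    and r: "product_of_commutators G m r"
    and eq: "desc_prod G f p = commutator G a b \<otimes> r"
    using prod by (auto simp: m product_of_commutators_Suc)
  have rG: "r \<in> carrier G"
    using r by (rule product_of_commutators_closed)
  define g where "g = (\<lambda>i\<in>?I. if i = 1 then f i \<otimes> inv r else f i)"
  have g: "g \<in> ?I \<rightarrow>\<^sub>E carrier G"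
    using f rG by (auto simp: g_def PiE_iff)
  have "desc_prod G g p = desc_prod G f p \<otimes> inv r"
    using f rG p by (intro desc_prod_mult_first) (auto simp: g_def PiE_iff)
  also have "\<dots> = commutator G a b"
    using a b rG by (simp add: eq m_assoc)
  finally obtain x y where xy: "x \<in> carrier W" "y \<in> carrier W" "commutator W x y = (g, id)"
    using wreath_product_commutator[OF p g a b] unfolding W_def by blast
  have "(f, id) = (g, id) \<otimes>\<^bsub>W\<^esub> \<epsilon> r"
    using f rG p
    by (auto simp: W_def \<epsilon>_def mult_wreath_product permute_coordinates_def g_def inv_id
        cyclic_perm_group_simps PiE_iff m_assoc intro!: extensionalityI[of _ ?I])
  with xy \<epsilon>.product_of_commutators_hom[OF r] show ?thesis
    unfolding m product_of_commutators_Suc by metis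
qed

theorem lemma5:
  fixes B :: "('a, 'b) monoid_scheme" and p :: nat
  assumes "group B" and "p \<ge> 2"
  shows "commutator_width (wreath_product B {1..p} (cyclic_perm_group p))
           \<le> max 1 (commutator_width B)"
proof (cases "commutator_width B")
  case infinity
  then show ?thesis
    by simp
next
  case (enat n)
  interpret B: group B
    by fact
  let ?W = "wreath_product B {1..p} (cyclic_perm_group p)"
  interpret W: group ?W
    by (rule group_wreath_product_cyclic) fact
  have "commutator_length ?W w \<le> enat (max 1 n)" if w: "w \<in> derived ?W (carrier ?W)" for w
  proof -
    obtain f s where fs: "w = (f, s)"
      by (cases w)
    have f: "f \<in> {1..p} \<rightarrow>\<^sub>E carrier B"
      using w W.derived_in_carrier[of "carrier ?W"] by (auto simp: fs carrier_wreath_product)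
    note D = B.derived_wreath_productD[OF w[unfolded fs]]
    have "commutator_length B (desc_prod B f p) \<le> commutator_width B"
      unfolding commutator_width_def by (intro SUP_upper D)
    then have "product_of_commutators B n (desc_prod B f p)"
      by (simp add: enat B.commutator_length_le_iff)
    \<comment> \<open>For abelian \<open>B\<close> the width \<open>n\<close> is 0, while the
      construction in the wreath product uses at least one commutator.\<close>
    then have "product_of_commutators B (max 1 n) (desc_prod B f p)"
      by (rule B.product_of_commutators_mono) simp
    then have "product_of_commutators ?W (max 1 n) (f, id)"
      using assms(2) f by (intro B.wreath_product_product_of_commutators) auto
    then show ?thesis
      unfolding W.commutator_length_le_iff by (simp add: fs D)
  qed
  then have "commutator_width ?W \<le> enat (max 1 n)"
    unfolding commutator_width_def by (intro SUP_least)
  then show ?thesis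
    by (simp add: enat one_enat_def)
qed

end
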